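(* Let $a\ge1$ and $k\ge 2$ be integers. If $\frac{2(a-3)}{3}\le k\le 2a+2$ and $k+2a\equiv 2\pmod 4$, then the starlike tree $T(a,a+1,a+2,\ldots,a+k)$ is not transmission irregular.
   Context: The transmission of a vertex $v$ of a graph $G$ is ${\rm Tr}_G(v)=\sum_{u\in V(G)} d_G(u,v)$; $G$ is transmission irregular if all its vertices have pairwise different transmissions. For $t\ge3$ and positive integers $k_1\le\cdots\le k_t$, the starlike tree $T(k_1,\ldots,k_t)$ is the tree obtained by attaching to a single vertex $t$ pendant paths of lengths $k_1,\ldots,k_t$. *)

theory Defs
  imports "Graph_Theory.Graph_Theory" "HOL-Number_Theory.Cong"
begin

text \<open>A finite simple graph is a digraph satisfying the locale \<^locale>\<open>graph\<close>: every edge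
  is represented by its two opposite arcs.  The distance is the least number of arcs of a walk,
  that is, the shortest-path distance for unit arc weights; it is \<open>\<infinity>\<close> if there is no walk.\<close>

definition gdist :: "('a, 'b) pre_digraph \<Rightarrow> 'a \<Rightarrow> 'a \<Rightarrow> ereal" where
  "gdist G u v = wf_digraph.\<mu> G (\<lambda>_. 1) u v"

definition transmission :: "('a, 'b) pre_digraph \<Rightarrow> 'a \<Rightarrow> ereal" where
  "transmission G v = (\<Sum>u\<in>verts G. gdist G u v)"

definition transmission_irregular :: "('a, 'b) pre_digraph \<Rightarrow> bool" where
  "transmission_irregular G \<longleftrightarrow>
    (\<forall>u\<in>verts G. \<forall>v\<in>verts G. u \<noteq> v \<longrightarrow> transmission G u \<noteq> transmission G v)"

datatype starlike_vertex = Center | Leg nat nat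

text \<open>The \<open>i\<close>-th pendant path, of length \<open>ks ! i\<close>, runs through
  \<open>leg_vertex i 0 = Center\<close>, \<open>leg_vertex i 1\<close>, \dots, \<open>leg_vertex i (ks ! i)\<close>.\<close>

fun leg_vertex :: "nat \<Rightarrow> nat \<Rightarrow> starlike_vertex" where
  "leg_vertex i 0 = Center"
| "leg_vertex i (Suc j) = Leg i (Suc j)"

definition starlike_edges :: "nat list \<Rightarrow> (starlike_vertex \<times> starlike_vertex) set" where
  "starlike_edges ks =
    {(leg_vertex i j, leg_vertex i (Suc j)) | i j. i < length ks \<and> j < ks ! i}"

definition starlike_tree ::
    "nat list \<Rightarrow> (starlike_vertex, starlike_vertex \<times> starlike_vertex) pre_digraph" where
  "starlike_tree ks = with_proj
    \<lparr> pverts = {Center} \<union> {leg_vertex i j | i j. i < length ks \<and> j \<le> ks ! i},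
      parcs = starlike_edges ks \<union> (starlike_edges ks)\<inverse> \<rparr>"

lemma graph_starlike_tree: "graph (starlike_tree ks)"
proof -
  have ne: "leg_vertex i j \<noteq> leg_vertex i (Suc j)" for i j
    by (cases j) auto
  have "{leg_vertex i j | i j. i < length ks \<and> j \<le> ks ! i}
      = (\<lambda>(i, j). leg_vertex i j) ` (SIGMA i:{..<length ks}. {..ks ! i})"
    by force
  then have finV: "finite {leg_vertex i j | i j. i < length ks \<and> j \<le> ks ! i}"
    by simp
  have "starlike_edges ks
      = (\<lambda>(i, j). (leg_vertex i j, leg_vertex i (Suc j))) ` (SIGMA i:{..<length ks}. {..<ks ! i})"
    unfolding starlike_edges_def by force
  then have finE: "finite (starlike_edges ks)"
    by simp
  have sub: "u \<in> {leg_vertex i j | i j. i < length ks \<and> j \<le> ks ! i} \<and>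
      v \<in> {leg_vertex i j | i j. i < length ks \<and> j \<le> ks ! i} \<and> u \<noteq> v"
    if "(u, v) \<in> starlike_edges ks" for u v
  proof -
    from that obtain i j where ij: "i < length ks" "j < ks ! i"
        "u = leg_vertex i j" "v = leg_vertex i (Suc j)"
      unfolding starlike_edges_def by auto
    then have "j \<le> ks ! i" "Suc j \<le> ks ! i" by auto
    with ij ne show ?thesis by blast
  qed
  interpret pair_graph "\<lparr> pverts = {Center} \<union> {leg_vertex i j | i j. i < length ks \<and> j \<le> ks ! i},
      parcs = starlike_edges ks \<union> (starlike_edges ks)\<inverse> \<rparr>"
  proof (unfold_locales, goal_cases)
    case (1 e) then show ?case using sub[of "fst e" "snd e"] sub[of "snd e" "fst e"] by (cases e) auto
  next
    case (2 e) then show ?case using sub[of "fst e" "snd e"] sub[of "snd e" "fst e"] by (cases e) auto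
  next
    case 3 then show ?case using finV by simp
  next
    case 4 then show ?case using finE by simp
  next
    case (5 e) then show ?case using sub[of "fst e" "snd e"] sub[of "snd e" "fst e"] by (cases e) auto
  next
    case 6 then show ?case
      by (auto simp: symmetric_def arcs_ends_conv sym_def image_def)
  qed
  show ?thesis
    unfolding starlike_tree_def by unfold_locales
qed

end

theory Submission
  imports Defs
begin

text \<open>On a starlike tree with \<open>N\<close> non-central vertices, the vertex at depth \<open>q\<close> on a leg of length
  \<open>L\<close> has transmission \<open>S + q (N + q - 2 L)\<close>, where \<open>S\<close> is the transmission of the center.  For the
  legs \<open>a, \<dots>, a + k\<close> put \<open>j = (a + k/2 - 1) / 2\<close>, an integer by the congruence hypothesis.  Then the
  vertex at depth \<open>j\<close> on the shortest leg and the one at depth \<open>j + 1\<close> on the longest leg have the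
  same transmission; \<open>k \<le> 2 a + 2\<close> says exactly that \<open>j \<le> a\<close>.\<close>

text \<open>Following arcs that lower \<open>f\<close> by one gives a walk to \<open>v\<close> of
  cost \<open>f u\<close>. Conversely, no arc lowers \<open>f\<close> by more than one and
  \<open>f v = 0\<close>, so every walk costs at least \<open>f u\<close>.\<close>

lemma (in wf_digraph) \<mu>_unit_eq_potential:
  fixes f :: "'a \<Rightarrow> nat"
  assumes u: "u \<in> verts G"
    and zero: "\<And>w. w \<in> verts G \<Longrightarrow> f w = 0 \<longleftrightarrow> w = v"
    and lip: "\<And>e. e \<in> arcs G \<Longrightarrow> f (tail G e) \<le> Suc (f (head G e))"
    and desc: "\<And>w. w \<in> verts G \<Longrightarrow> f w \<noteq> 0 \<Longrightarrow>
      \<exists>e\<in>arcs G. tail G e = w \<and> f w = Suc (f (head G e))"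
  shows "\<mu> (\<lambda>_. 1) u v = ereal (f u)"
proof (rule antisym)
  have "\<exists>p. awalk u p v \<and> awalk_cost (\<lambda>_. 1) p = real (f u)"
    using u
  proof (induction "f u" arbitrary: u)
    case 0
    then show ?case using zero[of u] by (intro exI[of _ "[]"]) (simp add: awalk_Nil_iff)
  next
    case (Suc n)
    then obtain e where e: "e \<in> arcs G" "tail G e = u" "f u = Suc (f (head G e))"
      using desc[of u] by auto
    moreover obtain p where "awalk (head G e) p v" "awalk_cost (\<lambda>_. 1) p = real (f (head G e))"
      using Suc e by fastforce
    ultimately show ?case
      by (intro exI[of _ "e # p"]) (simp add: awalk_Cons_iff)
  qed
  then show "\<mu> (\<lambda>_. 1) u v \<le> ereal (f u)"
    using min_cost_le_walk_cost by metis
next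
  have "real (f u) \<le> awalk_cost (\<lambda>_. 1) p" if "awalk u p v" for p
    using that
  proof (induction p arbitrary: u)
    case Nil
    then show ?case using zero[of u] by (auto simp: awalk_Nil_iff)
  next
    case (Cons e p)
    then show ?case using lip[of e] by (force simp: awalk_Cons_iff)
  qed
  then show "ereal (f u) \<le> \<mu> (\<lambda>_. 1) u v"
    unfolding \<mu>_def by (intro INF_greatest) simp
qed

text \<open>The intended distance to \<open>leg_vertex i q\<close>. With truncated subtraction,
  \<open>(p - q) + (q - p)\<close> is the absolute value of the difference.\<close>

fun leg_dist :: "nat \<Rightarrow> nat \<Rightarrow> starlike_vertex \<Rightarrow> nat" where
  "leg_dist i q Center = q"
| "leg_dist i q (Leg i' p) = (if i' = i then (p - q) + (q - p) else p + q)"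

text \<open>At \<open>p = 0\<close> both branches equal \<open>q\<close>, so \<open>Center\<close>
  fits the formula whichever leg it is read on.\<close>

lemma leg_dist_leg_vertex:
  "leg_dist i q (leg_vertex i' p) = (if i' = i then (p - q) + (q - p) else p + q)"
  by (cases p) auto

lemma arcs_starlike_tree [simp]:
  "arcs (starlike_tree ks) = starlike_edges ks \<union> (starlike_edges ks)\<inverse>"
  "tail (starlike_tree ks) = fst" "head (starlike_tree ks) = snd"
  by (simp_all add: starlike_tree_def)

lemma leg_vertex_in_verts:
  "i < length ks \<Longrightarrow> q \<le> ks ! i \<Longrightarrow> leg_vertex i q \<in> verts (starlike_tree ks)"
  by (auto simp: starlike_tree_def)

text \<open>\<open>Center\<close> has depth 0 on every leg. Assigning it to the chosen leg
  \<open>i\<close> lets a step from it towards a vertex of that leg count as a step along the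
  leg.\<close>

lemma verts_starlike_treeE:
  assumes "w \<in> verts (starlike_tree ks)" "i < length ks"
  obtains i' p where "i' < length ks" "p \<le> ks ! i'" "w = leg_vertex i' p" "p = 0 \<Longrightarrow> i' = i"
proof -
  consider "w = Center" | i' p where "i' < length ks" "p \<le> ks ! i'" "w = leg_vertex i' p" "p \<noteq> 0"
    using assms(1) leg_vertex.simps(1)
    by (fastforce simp: starlike_tree_def simp del: leg_vertex.simps)
  then show thesis
    by cases (use that[of i 0] assms(2) that in auto)
qed

text \<open>Here each vertex is listed exactly once, as a sum over vertices requires.\<close>

lemma verts_starlike_tree_eq:
  "verts (starlike_tree ks)
    = insert Center ((\<lambda>(i, p). Leg i p) ` (SIGMA i:{..<length ks}. {1..ks ! i}))"
proof -
  have "leg_vertex i p = (if p = 0 then Center else Leg i p)" for i p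
    by (cases p) auto
  then show ?thesis
    by (force simp: starlike_tree_def Suc_le_eq)
qed

lemma gdist_starlike_tree:
  assumes i: "i < length ks" and q: "q \<le> ks ! i" and u: "u \<in> verts (starlike_tree ks)"
  shows "gdist (starlike_tree ks) u (leg_vertex i q) = ereal (leg_dist i q u)"
proof -
  interpret graph "starlike_tree ks" by (rule graph_starlike_tree)
  show ?thesis
    unfolding gdist_def
  proof (rule \<mu>_unit_eq_potential[OF u])
    fix w assume w: "w \<in> verts (starlike_tree ks)"
    then obtain i' p where p: "i' < length ks" "p \<le> ks ! i'" "w = leg_vertex i' p" "p = 0 \<Longrightarrow> i' = i"
      using i by (rule verts_starlike_treeE) blast
    show "leg_dist i q w = 0 \<longleftrightarrow> w = leg_vertex i q"
      using p by (cases p; cases q) (auto simp: leg_dist_leg_vertex)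
    show "\<exists>e\<in>arcs (starlike_tree ks). tail (starlike_tree ks) e = w \<and>
        leg_dist i q w = Suc (leg_dist i q (head (starlike_tree ks) e))"
      if nz: "leg_dist i q w \<noteq> 0"
    \<comment> \<open>Below depth \<open>q\<close> on leg \<open>i\<close> the target lies outwards;
      from anywhere else it is approached by moving towards the center.\<close>
    proof (cases "i' = i \<and> p < q")
      case True
      then have "(w, leg_vertex i (Suc p)) \<in> starlike_edges ks"
        using p i q unfolding starlike_edges_def by auto
      moreover have "leg_dist i q w = Suc (leg_dist i q (leg_vertex i (Suc p)))"
        unfolding p(3) leg_dist_leg_vertex using True by (simp add: Suc_diff_Suc)
      ultimately show ?thesis
        by (intro bexI[of _ "(w, leg_vertex i (Suc p))"]) auto
    next
      case False
      \<comment> \<open>If \<open>p = 0\<close>, then \<open>i' = i\<close>, so the failed case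
        condition forces \<open>q = 0\<close> and the distance would vanish.\<close>
      with nz p obtain p' where p': "p = Suc p'"
        by (cases p) (auto simp: leg_dist_leg_vertex)
      then have "(leg_vertex i' p', w) \<in> starlike_edges ks"
        using p unfolding starlike_edges_def by auto
      moreover have "leg_dist i q w = Suc (leg_dist i q (leg_vertex i' p'))"
        using False nz unfolding p(3) p' leg_dist_leg_vertex by (auto split: if_splits)
      ultimately show ?thesis
        by (intro bexI[of _ "(w, leg_vertex i' p')"]) auto
    qed
  next
    fix e assume "e \<in> arcs (starlike_tree ks)"
    then obtain i' p where "e = (leg_vertex i' p, leg_vertex i' (Suc p)) \<or>
        e = (leg_vertex i' (Suc p), leg_vertex i' p)"
      by (cases e) (auto simp: starlike_edges_def)
    then show "leg_dist i q (tail (starlike_tree ks) e)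
        \<le> Suc (leg_dist i q (head (starlike_tree ks) e))"
      by (auto simp: leg_dist_leg_vertex simp del: leg_vertex.simps)
  qed
qed

text \<open>Replacing the distance by \<open>p + q\<close> overshoots by twice the minimum of
  \<open>p\<close> and \<open>q\<close>; over the leg this adds up to
  \<open>q (q + 1) + 2 q (L - q) = 2 q L - q (q - 1)\<close>.\<close>

lemma sum_leg_dist_same_leg:
  fixes q L :: nat
  assumes "q \<le> L"
  shows "(\<Sum>p=1..L. (p - q) + (q - p)) + 2 * q * L = (\<Sum>p=1..L. p + q) + q * (q - 1)"
  using assms
proof (induction L rule: dec_induct)
  case base
  \<comment> \<open>The upper end is separated from \<open>q\<close> so that the induction leaves
    \<open>q\<close> fixed.\<close>
  have "(\<Sum>p=1..n. (p - q) + (q - p)) + n * (n + 1) = (\<Sum>p=1..n. p + q)"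
    if "n \<le> q" for n :: nat
    using that
  proof (induction n)
    case (Suc n)
    then show ?case by (simp add: algebra_simps)
  qed simp
  from this[of q] show ?case by (cases q) (simp_all add: algebra_simps)
next
  case (step L)
  then show ?case by (simp add: algebra_simps)
qed

text \<open>Stated additively, since \<open>q * (N + q) - 2 * q * L\<close> could be truncated.\<close>

lemma transmission_starlike_tree:
  assumes i: "i < length ks" and q: "q \<le> ks ! i"
  obtains T where "transmission (starlike_tree ks) (leg_vertex i q) = ereal (real T)"
    and "T + 2 * q * ks ! i = (\<Sum>i<length ks. \<Sum>p=1..ks ! i. p) + q * (sum_list ks + q)"
proof
  define D where "D = (\<lambda>i'. \<Sum>p=1..ks ! i'. leg_dist i q (Leg i' p))"
  define T where "T = q + (\<Sum>i'<length ks. D i')"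
  have inj: "inj_on (\<lambda>(i, p). Leg i p) A" for A
    by (auto simp: inj_on_def)
  have "transmission (starlike_tree ks) (leg_vertex i q)
      = (\<Sum>u\<in>verts (starlike_tree ks). ereal (real (leg_dist i q u)))"
    unfolding transmission_def using i q by (intro sum.cong) (auto simp: gdist_starlike_tree)
  also have "\<dots> = ereal (real (\<Sum>u\<in>verts (starlike_tree ks). leg_dist i q u))"
    by simp
  also have "(\<Sum>u\<in>verts (starlike_tree ks). leg_dist i q u) = T"
    unfolding T_def D_def verts_starlike_tree_eq
    by (subst sum.insert)
      (auto simp: sum.reindex[OF inj] sum.Sigma intro!: sum.cong simp del: leg_dist.simps(2))
  finally show "transmission (starlike_tree ks) (leg_vertex i q) = ereal (real T)" .
  define E where "E = (\<lambda>i'. \<Sum>p=1..ks ! i'. p + q)"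
  have "D i + 2 * q * ks ! i = E i + q * (q - 1)"
    unfolding D_def E_def using sum_leg_dist_same_leg[OF q] by simp
  \<comment> \<open>On the other legs every path runs through the center, so nothing is
    overcounted.\<close>
  moreover have "(\<Sum>i'\<in>{..<length ks} - {i}. D i') = (\<Sum>i'\<in>{..<length ks} - {i}. E i')"
    unfolding D_def E_def by (intro sum.cong) auto
  ultimately have "(\<Sum>i'<length ks. D i') + 2 * q * ks ! i = (\<Sum>i'<length ks. E i') + q * (q - 1)"
    using i by (simp add: sum.remove[of "{..<length ks}" i])
  moreover have "(\<Sum>i'<length ks. E i')
      = (\<Sum>i<length ks. \<Sum>p=1..ks ! i. p) + q * sum_list ks"
    by (simp add: E_def sum.distrib sum_list_sum_nth atLeast0LessThan sum_distrib_left mult.commute)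
  \<comment> \<open>The summand \<open>q\<close> of \<open>Center\<close> turns
    \<open>q (q - 1)\<close> into the square of \<open>q\<close>.\<close>
  ultimately show "T + 2 * q * ks ! i
      = (\<Sum>i<length ks. \<Sum>p=1..ks ! i. p) + q * (sum_list ks + q)"
    unfolding T_def by (cases q) (simp_all add: algebra_simps)
qed

text \<open>There are \<open>2 m + 1\<close> consecutive terms with middle term
  \<open>a + m\<close>.\<close>

lemma sum_list_upt_even_length:
  "sum_list [a..<a + 2 * m + 1] = (2 * m + 1) * (a + m)"
  by (induction m) (simp_all add: algebra_simps)

theorem theorem2p6:
  fixes a k :: nat
  assumes "a \<ge> 1" and "k \<ge> 2"
    and "2 * (real a - 3) / 3 \<le> real k" and "k \<le> 2 * a + 2"
    and "[k + 2 * a = 2] (mod 4)"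
  shows "\<not> transmission_irregular (starlike_tree [a..<a + k + 1])"
proof -
  define ks where "ks = [a..<a + k + 1]"
  from assms(5) have "(k + 2 * a) mod 4 = 2"
    by (simp add: cong_def)
  then obtain j where j: "k + 2 * a = 4 * j + 2"
    by (metis mult_div_mod_eq)
  then obtain m where m: "k = 2 * m" "a + m = 2 * j + 1"
    by (intro that[of "k div 2"]) presburger+
  have "j \<le> a"
    using assms(4) j by simp
  have ks: "length ks = k + 1" "ks ! 0 = a" "ks ! k = a + k"
    by (auto simp: ks_def nth_append)
  have N: "sum_list ks = (2 * m + 1) * (2 * j + 1)"
    using sum_list_upt_even_length[of a m] by (simp only: ks_def m)
  obtain T where T: "transmission (starlike_tree ks) (leg_vertex 0 j) = ereal (real T)"
    "T + 2 * j * a = (\<Sum>i<length ks. \<Sum>p=1..ks ! i. p) + j * (sum_list ks + j)"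
    using transmission_starlike_tree[of 0 ks j] ks \<open>j \<le> a\<close> by auto
  obtain T' where T': "transmission (starlike_tree ks) (leg_vertex k (Suc j)) = ereal (real T')"
    "T' + 2 * Suc j * (a + k)
      = (\<Sum>i<length ks. \<Sum>p=1..ks ! i. p) + Suc j * (sum_list ks + Suc j)"
    using transmission_starlike_tree[of k ks "Suc j"] ks \<open>j \<le> a\<close> assms(2) by auto
  have a: "int a = 2 * int j + 1 - int m"
    using m(2) by linarith
  \<comment> \<open>With \<open>N\<close> the leg sum,
    \<open>T' - T = N + 2 j + 1 - 2 (j + 1) (a + k) + 2 j a\<close>. Substituting
    \<open>a = 2 j + 1 - m\<close> and \<open>a + k = 2 j + 1 + m\<close> leaves
    \<open>N - (2 m + 1) (2 j + 1) = 0\<close>.\<close>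
  have "int T = int T'"
    using arg_cong[OF T(2), of int] arg_cong[OF T'(2), of int]
    by (simp add: N m(1) a algebra_simps)
  with T(1) T'(1) have "transmission (starlike_tree ks) (leg_vertex 0 j)
      = transmission (starlike_tree ks) (leg_vertex k (Suc j))"
    by simp
  moreover have "leg_vertex 0 j \<noteq> leg_vertex k (Suc j)"
    by (cases j) auto
  moreover have "leg_vertex 0 j \<in> verts (starlike_tree ks)"
      "leg_vertex k (Suc j) \<in> verts (starlike_tree ks)"
    using ks \<open>j \<le> a\<close> assms(2) by (auto intro!: leg_vertex_in_verts simp del: leg_vertex.simps)
  ultimately show ?thesis
    unfolding transmission_irregular_def ks_def[symmetric] by blast
qed

end
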